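(* For every integer $n\geq 3$ there exists a smooth function $u:\mathbb{R}^{n}\to\mathbb{R}$ that is not a polynomial and satisfies $$\sigma_{2}\left(D^{2}u(x)\right)=1\quad\text{for all }x\in\mathbb{R}^{n}.$$
   Context: $D^2u$ denotes the Hessian matrix of $u$. For a real symmetric $n\times n$ matrix $M$ with eigenvalues $\lambda_1,\dots,\lambda_n$ (with multiplicity), $\sigma_2(M)=\sum_{1\le i<j\le n}\lambda_i\lambda_j$ (equivalently, the sum of the $2\times 2$ principal minors of $M$). *)

theory Defs
  imports
    "HOL-Analysis.Analysis"
    "HOL-Computational_Algebra.Polynomial"
begin

definition partial_deriv :: "'n::finite \<Rightarrow> (real^'n \<Rightarrow> real) \<Rightarrow> real^'n \<Rightarrow> real" where
  "partial_deriv i u x = deriv (\<lambda>t. u (x + t *\<^sub>R axis i 1)) 0"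

text \<open>The differentiability requirement at each stage guarantees that the derivatives taken by
  \<^const>\<open>partial_deriv\<close> (total via \<^const>\<open>deriv\<close>) are genuine.\<close>

primrec Ck_fun :: "nat \<Rightarrow> (real^'n::finite \<Rightarrow> real) \<Rightarrow> bool" where
  "Ck_fun 0 u \<longleftrightarrow> continuous_on UNIV u"
| "Ck_fun (Suc k) u \<longleftrightarrow> (\<forall>x. u differentiable (at x)) \<and> (\<forall>i. Ck_fun k (partial_deriv i u))"

definition smooth_fun :: "(real^'n::finite \<Rightarrow> real) \<Rightarrow> bool" where
  "smooth_fun u \<longleftrightarrow> (\<forall>k. Ck_fun k u)"

definition hessian :: "(real^'n::finite \<Rightarrow> real) \<Rightarrow> real^'n \<Rightarrow> real^'n^'n" where
  "hessian u x = (\<chi> i j. partial_deriv i (partial_deriv j u) x)"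

text \<open>The characteristic polynomial \<open>det (X I - M)\<close>, as a determinant over the ring of
  real polynomials.\<close>

definition charpoly :: "real^'n^'n::finite \<Rightarrow> real poly" where
  "charpoly M = det (\<chi> i j. (if i = j then [:0, 1:] else 0) - [:M $ i $ j:])"

text \<open>The real roots with multiplicity. For symmetric \<open>M\<close> the characteristic
  polynomial splits over the reals, so the list then has length \<open>CARD('n)\<close> and contains
  every eigenvalue with its multiplicity.\<close>

definition eigenvalues :: "real^'n^'n::finite \<Rightarrow> real list" where
  "eigenvalues M = sorted_list_of_multiset (proots (charpoly M))"

definition sigma2 :: "real^'n^'n::finite \<Rightarrow> real" where
  "sigma2 M = (let ev = eigenvalues M in \<Sum>j<length ev. \<Sum>i<j. ev ! i * ev ! j)"

end

theory Submission
  imports Defs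
begin

text \<open>After M. Warren: the function \<open>(x\<^sup>2 + y\<^sup>2 - 1) e\<^sup>t + e\<^sup>-\<^sup>t / 4\<close> of three of the coordinates works.
  Rotating the \<open>(x, y)\<close>-plane so that \<open>y = 0\<close> splits off the eigenvalue \<open>a = 2 e\<^sup>t\<close> of the Hessian
  and leaves a symmetric \<open>2\<times>2\<close> block with diagonal \<open>a, u\<^sub>t\<^sub>t\<close>; all other eigenvalues
  vanish. Hence the characteristic polynomial splits explicitly over the reals.\<close>

section \<open>Second elementary symmetric function via power sums\<close>

lemma sum_pairs_lessThan:
  fixes f :: "nat \<Rightarrow> 'a::comm_ring_1"
  shows "2 * (\<Sum>j<n. \<Sum>i<j. f i * f j) = (\<Sum>j<n. f j)\<^sup>2 - (\<Sum>j<n. (f j)\<^sup>2)"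
proof (induction n)
  case (Suc n)
  have "(\<Sum>i<n. f i * f n) = (\<Sum>i<n. f i) * f n"
    by (simp add: sum_distrib_right)
  with Suc show ?case
    by (simp add: power2_eq_square algebra_simps)
qed simp

text \<open>Power sums do not depend on the order of a list. Once Newton's identity is applied, the
  sorting in \<open>eigenvalues\<close> therefore drops out and only the multiset of roots
  matters.\<close>

lemma sum_pairs_list:
  fixes xs :: "real list"
  shows "(\<Sum>j<length xs. \<Sum>i<j. xs ! i * xs ! j) =
    ((\<Sum>x\<in>#mset xs. x)\<^sup>2 - (\<Sum>x\<in>#mset xs. x\<^sup>2)) / 2"
proof -
  have "(\<Sum>j<length xs. g (xs ! j)) = (\<Sum>x\<in>#mset xs. g x)" for g :: "real \<Rightarrow> real"
    using sum_mset_sum_list[of "map g xs"] by (simp add: sum_list_sum_nth atLeast0LessThan)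
  from this[of "\<lambda>x. x"] this[of "\<lambda>x. x\<^sup>2"] show ?thesis
    using sum_pairs_lessThan[of "\<lambda>i. xs ! i" "length xs"] by simp
qed

lemma sigma2_eq_proots:
  "sigma2 M = ((\<Sum>x\<in>#proots (charpoly M). x)\<^sup>2 - (\<Sum>x\<in>#proots (charpoly M). x\<^sup>2)) / 2"
  by (simp add: sigma2_def eigenvalues_def Let_def sum_pairs_list)

section \<open>Determinants of matrices that are diagonal outside three rows\<close>

lemma det_three_rows:
  fixes A :: "'a::comm_ring_1^'n^'n::finite"
  assumes d: "p \<noteq> q" "p \<noteq> r" "q \<noteq> r"
    and A: "\<forall>i j. i \<notin> {p, q, r} \<longrightarrow> i \<noteq> j \<longrightarrow> A $ i $ j = 0"
  shows "det A =
    (A$p$p * A$q$q * A$r$r + A$p$q * A$q$r * A$r$p + A$p$r * A$q$p * A$r$q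
     - A$p$p * A$q$r * A$r$q - A$p$q * A$q$p * A$r$r - A$p$r * A$q$q * A$r$p)
    * (\<Prod>i\<in>-{p, q, r}. A$i$i)"
proof -
  define S where "S = {p, q, r}"
  define R where "R = (\<Prod>i\<in>-S. A$i$i)"
  \<comment> \<open>A permutation moving some index outside \<open>S\<close> picks an off-diagonal
    entry of that row, which is 0. So only permutations of \<open>S\<close> survive in the Leibniz
    expansion.\<close>
  have "det A = (\<Sum>\<pi> | \<pi> permutes S. of_int (sign \<pi>) * (\<Prod>i\<in>UNIV. A$i$\<pi> i))"
    unfolding det_def
  proof (rule sum.mono_neutral_right)
    show "{\<pi>. \<pi> permutes S} \<subseteq> {\<pi>. \<pi> permutes (UNIV::'n set)}"
      using permutes_subset by blast
    show "\<forall>\<pi>\<in>{\<pi>. \<pi> permutes UNIV} - {\<pi>. \<pi> permutes S}.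
        of_int (sign \<pi>) * (\<Prod>i\<in>UNIV. A$i$\<pi> i) = 0"
    proof
      fix \<pi> assume "\<pi> \<in> {\<pi>. \<pi> permutes (UNIV::'n set)} - {\<pi>. \<pi> permutes S}"
      then obtain i where "i \<notin> S" "\<pi> i \<noteq> i"
        using permutes_superset[of \<pi> UNIV S] by auto
      then have "A$i$\<pi> i = 0"
        using A by (auto simp: S_def)
      then have "(\<Prod>i\<in>UNIV. A$i$\<pi> i) = 0"
        by (intro prod_zero bexI[of _ i]) auto
      then show "of_int (sign \<pi>) * (\<Prod>i\<in>UNIV. A$i$\<pi> i) = 0"
        by simp
    qed
  qed simp
  also have "\<dots> = (\<Sum>\<pi> | \<pi> permutes S. of_int (sign \<pi>) * (\<Prod>i\<in>S. A$i$\<pi> i) * R)"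
  proof (rule sum.cong[OF refl])
    fix \<pi> assume "\<pi> \<in> {\<pi>. \<pi> permutes S}"
    then have "(\<Prod>i\<in>-S. A$i$\<pi> i) = R"
      unfolding R_def by (intro prod.cong) (auto simp: permutes_def)
    moreover have "(\<Prod>i\<in>UNIV. A$i$\<pi> i) = (\<Prod>i\<in>S. A$i$\<pi> i) * (\<Prod>i\<in>-S. A$i$\<pi> i)"
      using prod.union_disjoint[of S "-S" "\<lambda>i. A$i$\<pi> i"] by (simp add: Compl_partition)
    ultimately show "of_int (sign \<pi>) * (\<Prod>i\<in>UNIV. A$i$\<pi> i) = of_int (sign \<pi>) * (\<Prod>i\<in>S. A$i$\<pi> i) * R"
      by (simp add: mult.assoc)
  qed
  also have "\<dots> = (\<Sum>\<pi> | \<pi> permutes S. of_int (sign \<pi>) * (\<Prod>i\<in>S. A$i$\<pi> i)) * R"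
    by (simp add: sum_distrib_right)
  also have "(\<Sum>\<pi> | \<pi> permutes S. of_int (sign \<pi>) * (\<Prod>i\<in>S. A$i$\<pi> i)) =
     A$p$p * A$q$q * A$r$r + A$p$q * A$q$r * A$r$p + A$p$r * A$q$p * A$r$q
     - A$p$p * A$q$r * A$r$q - A$p$q * A$q$p * A$r$r - A$p$r * A$q$q * A$r$p"
  proof -
    \<comment> \<open>Splitting off \<open>p\<close> and then \<open>q\<close> writes each
      permutation of \<open>S\<close> as a product of transpositions and leaves six explicit
      terms.\<close>
    have f: "finite {q, r}" "p \<notin> {q, r}" "finite {r}" "q \<notin> {r}"
      using d by auto
    show ?thesis
      unfolding S_def sum_over_permutations_insert[OF f(1,2)] sum_over_permutations_insert[OF f(3,4)]
        permutes_sing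
      using d d[symmetric]
      by (simp add: sign_swap_id sign_compose permutation_swap_id permutation_compose
          sign_id transpose_def)
  qed
  finally show ?thesis
    by (simp add: R_def S_def)
qed

section \<open>Partial derivatives and smoothness\<close>

lemma partial_derivI:
  assumes "((\<lambda>t. u (x + t *\<^sub>R axis i 1)) has_field_derivative D) (at 0)"
  shows "partial_deriv i u x = D"
  using assms by (simp add: partial_deriv_def DERIV_imp_deriv)

lemma partial_deriv_has_derivative:
  assumes "(u has_derivative u') (at x)"
  shows "partial_deriv i u x = u' (axis i 1)"
proof (rule partial_derivI)
  have "((\<lambda>t. u (x + t *\<^sub>R axis i 1)) has_derivative (\<lambda>t. u' (t *\<^sub>R axis i 1))) (at 0)"
    by (rule has_derivative_compose[where f = "\<lambda>t. x + t *\<^sub>R axis i 1" and g = u])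
      (use assms in \<open>auto intro!: derivative_eq_intros\<close>)
  then show "((\<lambda>t. u (x + t *\<^sub>R axis i 1)) has_field_derivative u' (axis i 1)) (at 0)"
    using has_derivative_bounded_linear[OF assms]
    by (simp add: has_field_derivative_def linear_cmul bounded_linear.linear mult.commute[of _ "u' _"])
qed

text \<open>An algebra of functions that contains \<open>warren\<close> and is closed under
  \<open>partial_deriv\<close>; the closure turns smoothness into a single induction on the order of
  differentiation.\<close>

inductive exp_poly :: "(real^'n::finite \<Rightarrow> real) \<Rightarrow> bool" where
  const: "exp_poly (\<lambda>x. c)"
| coord: "exp_poly (\<lambda>x. x $ i)"
| exp_coord: "exp_poly (\<lambda>x. exp (c * x $ i))"
| add: "exp_poly f \<Longrightarrow> exp_poly g \<Longrightarrow> exp_poly (\<lambda>x. f x + g x)"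
| mult: "exp_poly f \<Longrightarrow> exp_poly g \<Longrightarrow> exp_poly (\<lambda>x. f x * g x)"

text \<open>Both claims concern the same \<open>f'\<close>, so the sum and product rules stay inside
  the class. Taking \<open>v\<close> to be an axis vector later gives the partial
  derivatives.\<close>

lemma exp_poly_has_derivative:
  assumes "exp_poly f"
  shows "\<exists>f'. (\<forall>x. (f has_derivative f' x) (at x)) \<and> (\<forall>v. exp_poly (\<lambda>x. f' x v))"
  using assms
proof induction
  case (const c)
  show ?case
    by (rule exI[of _ "\<lambda>_ _. 0"]) (auto intro: exp_poly.intros)
next
  case (coord i)
  show ?case
    by (rule exI[of _ "\<lambda>_ v. v $ i"]) (auto intro: exp_poly.intros bounded_linear_imp_has_derivative bounded_linear_vec_nth)
next
  case (exp_coord c i)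
  show ?case
    by (rule exI[of _ "\<lambda>x v. (c * v $ i) * exp (c * x $ i)"])
      (auto intro!: exp_poly.intros derivative_eq_intros
        bounded_linear_imp_has_derivative bounded_linear_vec_nth)
next
  case (add f g)
  then obtain f' g' where "\<forall>x. (f has_derivative f' x) (at x)" "\<forall>v. exp_poly (\<lambda>x. f' x v)"
    "\<forall>x. (g has_derivative g' x) (at x)" "\<forall>v. exp_poly (\<lambda>x. g' x v)"
    by blast
  then show ?case
    by (intro exI[of _ "\<lambda>x v. f' x v + g' x v"]) (auto intro!: exp_poly.intros derivative_intros)
next
  case (mult f g)
  then obtain f' g' where "\<forall>x. (f has_derivative f' x) (at x)" "\<forall>v. exp_poly (\<lambda>x. f' x v)"
    "\<forall>x. (g has_derivative g' x) (at x)" "\<forall>v. exp_poly (\<lambda>x. g' x v)"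
    by blast
  with mult show ?case
    by (intro exI[of _ "\<lambda>x v. f x * g' x v + f' x v * g x"])
      (auto intro!: exp_poly.intros derivative_intros)
qed

lemma exp_poly_differentiable: "exp_poly f \<Longrightarrow> f differentiable (at x)"
  using exp_poly_has_derivative differentiable_def by blast

lemma exp_poly_partial_deriv:
  assumes "exp_poly f"
  shows "exp_poly (partial_deriv i f)"
proof -
  obtain f' where f': "\<forall>x. (f has_derivative f' x) (at x)" "\<forall>v. exp_poly (\<lambda>x. f' x v)"
    using exp_poly_has_derivative[OF assms] by blast
  then have "partial_deriv i f = (\<lambda>x. f' x (axis i 1))"
    by (auto intro: partial_deriv_has_derivative)
  with f' show ?thesis by simp
qed

lemma exp_poly_smooth:
  assumes "exp_poly f"
  shows "smooth_fun f"
proof -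
  have "Ck_fun k f" for k
    using assms
  proof (induction k arbitrary: f)
    case 0
    then show ?case
      by (auto simp: continuous_on_eq_continuous_at
          intro: differentiable_imp_continuous_within exp_poly_differentiable)
  next
    case (Suc k)
    then show ?case
      by (auto intro: exp_poly_differentiable exp_poly_partial_deriv)
  qed
  then show ?thesis
    by (simp add: smooth_fun_def)
qed

section \<open>The function, its smoothness and its non-polynomiality\<close>

text \<open>For distinct \<open>p\<close>, \<open>q\<close>, \<open>r\<close>, differentiating twice
  along \<open>r\<close> reproduces the function. The \<open>- 1\<close> cancels the product of the
  two diagonal Hessian entries \<open>2 * exp (x$r)\<close> in \<open>sigma2\<close>, and the factor
  1/4 normalises the remaining constant to 1.\<close>

definition warren :: "'n::finite \<Rightarrow> 'n \<Rightarrow> 'n \<Rightarrow> real^'n \<Rightarrow> real" where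
  "warren p q r x = ((x$p)\<^sup>2 + (x$q)\<^sup>2 - 1) * exp (x$r) + exp (- x$r) / 4"

lemma smooth_warren: "smooth_fun (warren p q r)"
proof (rule exp_poly_smooth)
  have "exp_poly (\<lambda>x. (x$p * x$p + x$q * x$q + (-1)) * exp (1 * x$r) + exp ((-1) * x$r) * (1/4))"
    by (intro exp_poly.intros)
  then show "exp_poly (warren p q r)"
    by (simp add: warren_def[abs_def] power2_eq_square)
qed

lemma not_polynomial_warren:
  fixes p q r :: "'n::finite"
  assumes d: "p \<noteq> q" "p \<noteq> r" "q \<noteq> r"
  shows "\<not> real_polynomial_function (warren p q r)"
proof
  assume poly: "real_polynomial_function (warren p q r)"
  \<comment> \<open>On this line the coordinates \<open>p\<close> and \<open>q\<close> are 1 and 0,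
    which kills the first summand; the coordinate \<open>r\<close> is \<open>- s\<close>, so the
    second becomes \<open>exp s / 4\<close>.\<close>
  define L :: "real \<Rightarrow> real^'n" where "L s = axis p 1 - s *\<^sub>R axis r 1" for s
  have "polynomial_function L"
    unfolding L_def by (intro polynomial_function_diff polynomial_function_const
        polynomial_function_mult[where f = "\<lambda>s. s"]) (auto simp: real_polynomial_function.intros)
  then have "real_polynomial_function (warren p q r \<circ> L)"
    using poly by (rule real_polynomial_function_compose)
  moreover have "(warren p q r \<circ> L) = (\<lambda>s. exp s / 4)"
    using d by (auto simp: warren_def L_def axis_def fun_eq_iff)
  ultimately obtain a n where a: "(\<lambda>s::real. exp s / 4) = (\<lambda>s. \<Sum>i\<le>n. a i * s ^ i)"
    by (auto simp: real_polynomial_function_iff_sum)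
  \<comment> \<open>After division by \<open>exp s\<close> every monomial tends to 0 at infinity,
    whereas the whole sum is constantly 1/4.\<close>
  have "(\<Sum>i\<le>n. a i * (s ^ i / exp s)) = 1/4" for s
  proof -
    have "(\<Sum>i\<le>n. a i * (s ^ i / exp s)) = (\<Sum>i\<le>n. a i * s ^ i) / exp s"
      by (simp add: sum_divide_distrib)
    also have "\<dots> = 1/4"
      unfolding fun_cong[OF a, of s, symmetric] by simp
    finally show ?thesis .
  qed
  moreover have "((\<lambda>s::real. \<Sum>i\<le>n. a i * (s ^ i / exp s)) \<longlongrightarrow> (\<Sum>i\<le>n. a i * 0)) at_top"
    by (intro tendsto_intros tendsto_power_div_exp_0)
  ultimately have "((\<lambda>s::real. 1/4 :: real) \<longlongrightarrow> 0) at_top"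
    by (simp only: mult_zero_right sum.neutral_const)
  then show False
    by (simp add: tendsto_const_iff)
qed

section \<open>The Hessian and its eigenvalues\<close>

lemma partial_deriv_warren:
  assumes d: "p \<noteq> q" "p \<noteq> r" "q \<noteq> r"
  shows "partial_deriv j (warren p q r) =
    (if j = p then (\<lambda>x. 2 * x$p * exp (x$r)) else if j = q then (\<lambda>x. 2 * x$q * exp (x$r))
     else if j = r then (\<lambda>x. ((x$p)\<^sup>2 + (x$q)\<^sup>2 - 1) * exp (x$r) - exp (- x$r) / 4) else (\<lambda>x. 0))"
proof (rule ext, rule partial_derivI)
  fix x
  consider "j = p" | "j = q" | "j = r" | "p \<noteq> j" "q \<noteq> j" "r \<noteq> j" by blast
  then show "((\<lambda>t. warren p q r (x + t *\<^sub>R axis j 1)) has_field_derivative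
    (if j = p then (\<lambda>x. 2 * x$p * exp (x$r)) else if j = q then (\<lambda>x. 2 * x$q * exp (x$r))
     else if j = r then (\<lambda>x. ((x$p)\<^sup>2 + (x$q)\<^sup>2 - 1) * exp (x$r) - exp (- x$r) / 4) else (\<lambda>x. 0)) x) (at 0)"
    using d d[symmetric] unfolding warren_def
    by cases (simp_all add: axis_def, (auto intro!: derivative_eq_intros)+)
qed

lemma hessian_warren:
  assumes d: "p \<noteq> q" "p \<noteq> r" "q \<noteq> r"
  shows "hessian (warren p q r) x $ i $ j =
    (if i = p then (if j = p then 2 * exp (x$r) else if j = r then 2 * x$p * exp (x$r) else 0)
     else if i = q then (if j = q then 2 * exp (x$r) else if j = r then 2 * x$q * exp (x$r) else 0)
     else if i = r then (if j = p then 2 * x$p * exp (x$r) else if j = q then 2 * x$q * exp (x$r)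
       else if j = r then warren p q r x else 0)
     else 0)" (is "_ = ?R")
proof -
  \<comment> \<open>\<open>hessian\<close> differentiates along \<open>j\<close> first, so the case
    split on \<open>j\<close> selects the closed form that is then differentiated along
    \<open>i\<close>.\<close>
  consider "j = p" | "j = q" | "j = r" | "j \<noteq> p" "j \<noteq> q" "j \<noteq> r" by blast
  then have "partial_deriv i (partial_deriv j (warren p q r)) x = ?R"
    using d d[symmetric] unfolding partial_deriv_warren[OF d] warren_def
    by cases (simp_all, (auto simp: axis_def intro!: partial_derivI derivative_eq_intros)+)
  then show ?thesis
    by (simp add: hessian_def)
qed

text \<open>With rho^2 = x_p^2 + x_q^2, \<open>l 1\<close> and \<open>l (-1)\<close> are the
  eigenvalues of the rotated block with rows (a, a rho) and (a rho, u). Its discriminant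
  \<open>D\<close> is nonnegative, so both are real, and \<open>proots\<close> can be read off the
  linear factors.\<close>

lemma charpoly_hessian_warren:
  fixes p q r :: "'n::finite"
  assumes d: "p \<noteq> q" "p \<noteq> r" "q \<noteq> r"
  defines "a x \<equiv> 2 * exp (x$r)"
  defines "D x \<equiv> (a x - warren p q r x)\<^sup>2 + 4 * (a x)\<^sup>2 * ((x$p)\<^sup>2 + (x$q)\<^sup>2)"
  defines "l s x \<equiv> (a x + warren p q r x + s * sqrt (D x)) / 2"
  shows "charpoly (hessian (warren p q r) x) =
    [:- a x, 1:] * ([:- l 1 x, 1:] * ([:- l (-1) x, 1:] * [:0, 1:] ^ card (- {p, q, r})))"
proof -
  define H where "H = hessian (warren p q r) x"
  define A where "A = (\<chi> i j. (if i = j then [:0, 1:] else 0) - [:H $ i $ j:])"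
  define w where "w = warren p q r x"
  define b where "b = 2 * x$p * exp (x$r)"
  define c where "c = 2 * x$q * exp (x$r)"
  note H = hessian_warren[OF d, of x, folded H_def]
  have D: "(sqrt (D x))\<^sup>2 = (a x - w)\<^sup>2 + 4 * (b\<^sup>2 + c\<^sup>2)"
  proof -
    have "(sqrt (D x))\<^sup>2 = D x"
      unfolding D_def by (intro real_sqrt_pow2) auto
    then show ?thesis
      by (simp add: D_def a_def b_def c_def w_def power_mult_distrib algebra_simps)
  qed
  have entries: "A$p$p = [:- a x, 1:]" "A$q$q = [:- a x, 1:]" "A$r$r = [:- w, 1:]"
    "A$p$q = 0" "A$q$p = 0" "A$p$r = [:- b:]" "A$r$p = [:- b:]" "A$q$r = [:- c:]" "A$r$q = [:- c:]"
    using d d[symmetric] by (auto simp: A_def H a_def b_def c_def w_def)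
  have "A$i$i = [:0, 1:]" if "i \<in> - {p, q, r}" for i
    using that by (auto simp: A_def H)
  then have P: "(\<Prod>i\<in>-{p, q, r}. A$i$i) = [:0, 1:] ^ card (- {p, q, r})"
    by simp
  have off: "\<forall>i j. i \<notin> {p, q, r} \<longrightarrow> i \<noteq> j \<longrightarrow> A$i$j = 0"
    by (auto simp: A_def H)
  \<comment> \<open>Vieta's formulas: the product and the sum of the two roots are the determinant
    and the trace of the block.\<close>
  have prod: "l 1 x * l (-1) x = a x * w - b\<^sup>2 - c\<^sup>2"
  proof -
    have "l 1 x * l (-1) x = ((a x + w)\<^sup>2 - (sqrt (D x))\<^sup>2) / 4"
      by (simp add: l_def w_def power2_eq_square algebra_simps add_divide_distrib diff_divide_distrib)
    then show ?thesis
      unfolding D by (simp add: power2_eq_square algebra_simps)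
  qed
  have sum: "l 1 x + l (-1) x = a x + w"
    by (simp add: l_def w_def field_simps)
  have "charpoly H = det A"
    by (simp add: charpoly_def A_def)
  \<comment> \<open>As the entries (p, q) and (q, p) vanish, three of the six terms remain and all
    contain the factor \<open>[:- a x, 1:]\<close>. It is taken out directly, without performing the
    rotation.\<close>
  also have "\<dots> = ([:- a x, 1:] * [:- a x, 1:] * [:- w, 1:] - [:- a x, 1:] * ([:b\<^sup>2:] + [:c\<^sup>2:]))
      * [:0, 1:] ^ card (- {p, q, r})"
    unfolding det_three_rows[OF d off] P entries
    by (simp add: power2_eq_square algebra_simps)
  also have "[:- a x, 1:] * [:- a x, 1:] * [:- w, 1:] - [:- a x, 1:] * ([:b\<^sup>2:] + [:c\<^sup>2:]) =
      [:- a x, 1:] * ([:- a x, 1:] * [:- w, 1:] - [:b\<^sup>2 + c\<^sup>2:])"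
    by (simp only: right_diff_distrib mult.assoc) simp
  also have "[:- a x, 1:] * [:- w, 1:] - [:b\<^sup>2 + c\<^sup>2:] = [:l 1 x * l (-1) x, - (l 1 x + l (-1) x), 1:]"
    by (simp only: prod sum) simp
  also have "\<dots> = [:- l 1 x, 1:] * [:- l (-1) x, 1:]"
    by simp
  finally show ?thesis
    by (simp only: H_def mult.assoc)
qed

lemma sigma2_hessian_warren:
  fixes p q r :: "'n::finite"
  assumes d: "p \<noteq> q" "p \<noteq> r" "q \<noteq> r"
  shows "sigma2 (hessian (warren p q r) x) = 1"
proof -
  define a where "a = 2 * exp (x$r)"
  define w where "w = warren p q r x"
  define D where "D = (a - w)\<^sup>2 + 4 * a\<^sup>2 * ((x$p)\<^sup>2 + (x$q)\<^sup>2)"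
  define l where "l s = (a + w + s * sqrt D) / 2" for s
  define k where "k = card (- {p, q, r})"
  have D: "(sqrt D)\<^sup>2 = D"
    unfolding D_def by (intro real_sqrt_pow2) auto
  have "charpoly (hessian (warren p q r) x) =
      [:- a, 1:] * ([:- l 1, 1:] * ([:- l (-1), 1:] * [:0, 1:] ^ k))"
    using charpoly_hessian_warren[OF d, of x] unfolding a_def w_def D_def l_def k_def .
  also have "proots \<dots> = {#a, l 1, l (-1)#} + repeat_mset k {#0#}"
    by (simp add: proots_mult proots_power del: mult_pCons_left mult_pCons_right)
  finally have roots: "proots (charpoly (hessian (warren p q r) x)) =
      {#a, l 1, l (-1)#} + repeat_mset k {#0#}" .
  \<comment> \<open>The remaining eigenvalues are 0 and contribute to neither power sum.\<close>
  have zero: "(\<Sum>y\<in>#repeat_mset k {#0::real#}. y) = 0" "(\<Sum>y\<in>#repeat_mset k {#0::real#}. y\<^sup>2) = 0"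
    by (induction k) auto
  have "l 1 + l (-1) = a + w"
    by (simp add: l_def field_simps)
  \<comment> \<open>The terms linear in \<open>sqrt D\<close> cancel, so only \<open>D\<close>
    itself survives.\<close>
  moreover have "(l 1)\<^sup>2 + (l (-1))\<^sup>2 = ((a + w)\<^sup>2 + D) / 2"
  proof -
    have "(l 1)\<^sup>2 + (l (-1))\<^sup>2 = ((a + w)\<^sup>2 + (sqrt D)\<^sup>2) / 2"
      by (simp add: l_def power2_eq_square field_simps)
    then show ?thesis
      unfolding D .
  qed
  moreover have "sigma2 (hessian (warren p q r) x) =
      ((a + (l 1 + l (-1)))\<^sup>2 - (a\<^sup>2 + ((l 1)\<^sup>2 + (l (-1))\<^sup>2))) / 2"
    by (simp add: sigma2_eq_proots roots zero add.assoc)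
  ultimately have "sigma2 (hessian (warren p q r) x) =
      ((a + (a + w))\<^sup>2 - (a\<^sup>2 + ((a + w)\<^sup>2 + D) / 2)) / 2"
    by (simp only:)
  \<comment> \<open>This is the sum of the principal 2 by 2 minors: a^2, a w - (a x_p)^2 and a w -
    (a x_q)^2.\<close>
  also have "\<dots> = a\<^sup>2 + 2 * a * w - a\<^sup>2 * ((x$p)\<^sup>2 + (x$q)\<^sup>2)"
    by (simp add: D_def power2_eq_square field_simps)
  also have "\<dots> = exp (x$r) * exp (- x$r)"
    by (simp add: a_def w_def warren_def power2_eq_square algebra_simps)
  also have "\<dots> = 1"
    by (simp flip: exp_add)
  finally show ?thesis .
qed

theorem corollary2:
  assumes "CARD('n::finite) \<ge> 3"
  shows "\<exists>u :: real^'n \<Rightarrow> real.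
           smooth_fun u \<and> \<not> real_polynomial_function u \<and> (\<forall>x. sigma2 (hessian u x) = 1)"
proof -
  obtain S :: "'n set" where "card S = 3"
    using assms by (metis obtain_subset_with_card_n)
  then obtain p q r :: 'n where "p \<noteq> q" "p \<noteq> r" "q \<noteq> r"
    by (auto simp: card_3_iff)
  then show ?thesis
    by (intro exI[of _ "warren p q r"] conjI allI smooth_warren not_polynomial_warren
        sigma2_hessian_warren)
qed

end
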